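(* (i) Let $f:\mathbb{R}\to\mathbb{R}$ be a flux function and let $\hat f:\mathbb{R}^2\to\mathbb{R}$ be a two-point numerical flux consistent with $f$. If $\hat f$ is a monotone flux, then $\hat f$ is an E flux, i.e. for all $v,w\in\mathbb{R}$ and all $u$ between $v$ and $w$, $$\operatorname{sgn}(w-v)\,\bigl(\hat f(v,w)-f(u)\bigr)\le 0.$$ (ii) The converse does not hold in general: there exist a flux function $f$ and a two-point numerical flux consistent with $f$ that is an E flux but is not a monotone flux.
   Context: Consider the scalar conservation law $u_t+f(u)_x=0$ with flux function $f:\mathbb{R}\to\mathbb{R}$ (continuously differentiable), and its conservative semi-discretization $\frac{d}{dt}u_j=-\frac1h(\hat f_{j+1/2}-\hat f_{j-1/2})$, $j\in\mathbb{Z}$, $h>0$. A two-point numerical flux is a Lipschitz continuous function $\hat f:\mathbb{R}^2\to\mathbb{R}$, used as $\hat f_{j+1/2}=\hat f(u_j,u_{j+1})$, that is consistent with $f$: $\hat f(u,u)=f(u)$ for all $u\in\mathbb{R}$. It is called a monotone flux if $\hat f(v,w)$ is non-decreasing in its first argument $v$ and non-increasing in its second argument $w$. It is called an E flux if $\operatorname{sgn}(w-v)(\hat f(v,w)-f(u))\le 0$ for all $v,w\in\mathbb{R}$ and every $u$ between $v$ and $w$. Here $\operatorname{sgn}(0)=0$. *)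

theory Defs
  imports "HOL-Analysis.Analysis"
begin

definition flux_function :: "(real \<Rightarrow> real) \<Rightarrow> bool" where
  "flux_function f \<longleftrightarrow> f C1_differentiable_on UNIV"

(* The pair (v, w) stands for (u_j, u_{j+1}); Lipschitz continuity is global on R^2, with
   respect to the Euclidean distance. *)
definition two_point_flux :: "(real \<Rightarrow> real) \<Rightarrow> (real \<times> real \<Rightarrow> real) \<Rightarrow> bool" where
  "two_point_flux f fh \<longleftrightarrow> (\<exists>L. L-lipschitz_on UNIV fh) \<and> (\<forall>u. fh (u, u) = f u)"

definition monotone_flux :: "(real \<times> real \<Rightarrow> real) \<Rightarrow> bool" where
  "monotone_flux fh \<longleftrightarrow>
     (\<forall>w. mono (\<lambda>v. fh (v, w))) \<and> (\<forall>v. antimono (\<lambda>w. fh (v, w)))"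

definition E_flux :: "(real \<Rightarrow> real) \<Rightarrow> (real \<times> real \<Rightarrow> real) \<Rightarrow> bool" where
  "E_flux f fh \<longleftrightarrow>
     (\<forall>v w. \<forall>u \<in> {min v w..max v w}. sgn (w - v) * (fh (v, w) - f u) \<le> 0)"

end

theory Submission imports Defs
begin

text \<open>
  A monotone flux is an E flux because \<open>f u\<close> is the value of the numerical flux at the diagonal
  point \<open>(u, u)\<close>: if \<open>u\<close> lies between \<open>v\<close> and \<open>w\<close>, one reaches \<open>(u, u)\<close> from \<open>(v, w)\<close> by moving
  first the left state and then the right state towards \<open>u\<close>. Monotonicity makes both moves change
  the flux in the same direction, the one that the sign in the E condition asks for.

  The converse fails because the E condition compares off-diagonal values with diagonal values
  only, so it leaves free how the flux varies away from the diagonal. For \<open>f = 0\<close> it says just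
  that the flux is nonpositive where \<open>v < w\<close> and nonnegative where \<open>w < v\<close>. A bump in the jump
  \<open>v - w\<close> that is supported on positive jumps satisfies this, but decreases in \<open>v\<close> past its peak.
\<close>

lemma monotone_flux_imp_E_flux:
  assumes consistent: "\<And>u. fh (u, u) = f u" and "monotone_flux fh"
  shows "E_flux f fh"
  unfolding E_flux_def
proof (intro allI ballI)
  fix v w u :: real
  assume u: "u \<in> {min v w..max v w}"
  have left: "fh (a, c) \<le> fh (b, c)" and right: "fh (c, b) \<le> fh (c, a)" if "a \<le> b" for a b c
    using assms(2) that unfolding monotone_flux_def by (auto dest: monoD antimonoD)
  consider "v < w" | "v = w" | "w < v" by linarith
  then show "sgn (w - v) * (fh (v, w) - f u) \<le> 0"
  proof cases
    case 1
    then have "fh (v, w) \<le> fh (u, w)" "fh (u, w) \<le> fh (u, u)"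
      using u by (auto intro: left right)
    then show ?thesis using 1 consistent[of u] by simp
  next
    case 2
    then show ?thesis by simp
  next
    case 3
    then have "fh (u, u) \<le> fh (u, w)" "fh (u, w) \<le> fh (v, w)"
      using u by (auto intro: left right)
    then show ?thesis using 3 consistent[of u] by simp
  qed
qed

definition bump_flux :: "real \<times> real \<Rightarrow> real" where
  "bump_flux p = max 0 (1 - \<bar>fst p - snd p - 1\<bar>)"

text \<open>
  The bump is 1-Lipschitz in the jump, and the jump is 2-Lipschitz in the pair of states, since
  each coordinate of a pair moves by at most the Euclidean distance.
\<close>

lemma lipschitz_bump_flux: "2-lipschitz_on UNIV bump_flux"
proof (rule lipschitz_onI)
  fix p q :: "real \<times> real"
  have "\<bar>fst p - fst q\<bar> \<le> dist p q" "\<bar>snd p - snd q\<bar> \<le> dist p q"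
    using dist_fst_le[of p q] dist_snd_le[of p q] by (simp_all add: dist_real_def)
  then show "dist (bump_flux p) (bump_flux q) \<le> 2 * dist p q"
    unfolding bump_flux_def dist_real_def by linarith
qed simp

lemma two_point_flux_bump_flux: "two_point_flux (\<lambda>_. 0) bump_flux"
  using lipschitz_bump_flux by (auto simp: two_point_flux_def bump_flux_def)

lemma E_flux_bump_flux: "E_flux (\<lambda>_. 0) bump_flux"
  by (auto simp: E_flux_def bump_flux_def sgn_if)

lemma not_monotone_bump_flux: "\<not> monotone_flux bump_flux"
proof
  assume "monotone_flux bump_flux"
  then have "mono (\<lambda>v. bump_flux (v, 0))"
    by (simp add: monotone_flux_def)
  \<comment> \<open>The jump 1 is the peak of the bump, and at the jump 2 the bump has returned to 0.\<close>
  then have "bump_flux (1, 0) \<le> bump_flux (2, 0)"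
    by (rule monoD) simp
  then show False
    by (simp add: bump_flux_def)
qed

theorem lemma2p1:
  "(\<forall>(f :: real \<Rightarrow> real) (fh :: real \<times> real \<Rightarrow> real).
      flux_function f \<longrightarrow> two_point_flux f fh \<longrightarrow> monotone_flux fh \<longrightarrow> E_flux f fh) \<and>
   (\<exists>(f :: real \<Rightarrow> real) (fh :: real \<times> real \<Rightarrow> real).
      flux_function f \<and> two_point_flux f fh \<and> E_flux f fh \<and> \<not> monotone_flux fh)"
proof (rule conjI)
  show "\<forall>f fh. flux_function f \<longrightarrow> two_point_flux f fh \<longrightarrow> monotone_flux fh \<longrightarrow> E_flux f fh"
    using monotone_flux_imp_E_flux by (auto simp: two_point_flux_def)
  have "flux_function (\<lambda>_. 0)"
    by (simp add: flux_function_def)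
  then show "\<exists>f fh. flux_function f \<and> two_point_flux f fh \<and> E_flux f fh \<and> \<not> monotone_flux fh"
    using two_point_flux_bump_flux E_flux_bump_flux not_monotone_bump_flux by blast
qed

end
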